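(* For each $\lambda \in [0,1)$, there exists a subset $S = S(\lambda)$ of $\mathbb{R}$ such that $\vert S \cap I \vert \geq \lambda$ for every interval $I \subset \mathbb{R}$ of unit length, but such that $S$ does not contain any (infinite) arithmetic progression.
   Context: $\mathbb{N}$ denotes the natural numbers including $0$. A subset $S$ of $\mathbb{R}$ contains an (infinite) arithmetic progression if there exist a point $x \in S$ and a real number $\Delta \neq 0$ such that $x + \Delta\mathbb{N} = \{x + n\Delta : n \in \mathbb{N}\} \subseteq S$. For a Lebesgue measurable set $A \subseteq \mathbb{R}$, $\vert A \vert$ denotes its Lebesgue measure; writing $\vert A\vert$ presupposes that $A$ is Lebesgue measurable. *)

theory Defs
  imports "HOL-Analysis.Analysis"
begin

definition contains_arith_prog :: "real set \<Rightarrow> bool" where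
  "contains_arith_prog S \<longleftrightarrow>
     (\<exists>x\<in>S. \<exists>\<Delta>. \<Delta> \<noteq> 0 \<and> {x + real n * \<Delta> | n. True} \<subseteq> S)"

(* Open, closed and half-open intervals are all covered. The length is the emeasure, so an
   unbounded interval has infinite length rather than the junk value that measure would give. *)
definition unit_length_interval :: "real set \<Rightarrow> bool" where
  "unit_length_interval I \<longleftrightarrow> is_interval I \<and> emeasure lebesgue I = 1"

end

theory Submission
  imports Defs
begin

text \<open>
  The complement of \<open>S\<close> is the union of \<open>\<int> + [0, \<epsilon>)\<close> and \<open>c\<int> + [0, c\<epsilon>)\<close> for an irrational
  \<open>c \<in> [1, 2]\<close> and a small \<open>\<epsilon>\<close>.  For \<open>\<Delta> \<noteq> 0\<close> the numbers \<open>\<Delta>\<close> and \<open>\<Delta> / c\<close> cannot both be rational,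
  so by Kronecker's theorem every progression with difference \<open>\<Delta>\<close> is dense modulo \<open>1\<close> or
  modulo \<open>c\<close>, and therefore meets this union.
\<close>

text \<open>For \<open>c > 0\<close> this is the union of the intervals
  \<open>[c * k, c * k + c * \<epsilon>)\<close> over integers k. Writing it with
  \<open>frac\<close> makes the period \<open>c\<close> and Borel measurability immediate.\<close>

definition periodic_gap :: "real \<Rightarrow> real \<Rightarrow> real set" where
  "periodic_gap c \<epsilon> = {x. frac (x / c) < \<epsilon>}"

lemma borel_periodic_gap [measurable]: "periodic_gap c \<epsilon> \<in> sets borel"
  unfolding periodic_gap_def frac_def by measurable

text \<open>Kronecker: the positive multiples of an irrational number are dense modulo 1, so after
  division by \<open>c\<close> the progression enters every window modulo 1.\<close>

lemma arith_prog_meets_periodic_gap: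
  fixes x \<Delta> :: real
  assumes "\<Delta> / c \<notin> \<rat>" "\<epsilon> > 0"
  shows "\<exists>n. x + real n * \<Delta> \<in> periodic_gap c \<epsilon>"
proof -
  \<comment> \<open>The target is the midpoint of \<open>(0, \<epsilon>)\<close> shifted back by the
    starting point \<open>x / c\<close>; tolerance \<open>\<epsilon>/2\<close> keeps the term inside
    this window.\<close>
  obtain h k where k: "k > 0"
    and hk: "\<bar>of_int k * (\<Delta> / c) - of_int h - (\<epsilon>/2 - x / c)\<bar> < \<epsilon>/2"
    by (rule sequence_of_fractional_parts_is_dense[OF assms(1) half_gt_zero[OF assms(2)]])
  define y where "y = (x + real (nat k) * \<Delta>) / c - of_int h"
  have "y = of_int k * (\<Delta> / c) - of_int h + x / c"
    using k by (simp add: y_def add_divide_distrib)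
  with hk have y: "0 < y" "y < \<epsilon>"
    by linarith+
  have "frac ((x + real (nat k) * \<Delta>) / c) = frac y"
    by (simp add: y_def frac_def)
  \<comment> \<open>Since \<open>y > 0\<close> its floor is nonnegative, so this holds even if
    \<open>\<epsilon>\<close> exceeds 1.\<close>
  also have "\<dots> \<le> y"
    using y by (simp add: frac_def)
  finally show ?thesis
    using y unfolding periodic_gap_def by (intro exI[of _ "nat k"]) simp
qed

text \<open>As \<open>c \<ge> 1\<close>, a window of length 2 is covered by at most two periods and
  so meets at most three gaps, each of length at most
  \<open>c * \<epsilon> \<le> 2 * \<epsilon>\<close>.\<close>

lemma measure_periodic_gap_le:
  fixes a c \<epsilon> :: real
  assumes "1 \<le> c" "c \<le> 2" "\<epsilon> > 0"
  shows "measure lebesgue (periodic_gap c \<epsilon> \<inter> {a - 1..a + 1}) \<le> 6 * \<epsilon>"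
proof -
  define K where "K = {\<lfloor>a / c\<rfloor> - 1..\<lfloor>a / c\<rfloor> + 1}"
  define J where "J k = {c * of_int k..c * of_int k + c * \<epsilon>}" for k
  have "periodic_gap c \<epsilon> \<inter> {a - 1..a + 1} \<subseteq> (\<Union>k\<in>K. J k)"
  proof
    fix x assume x: "x \<in> periodic_gap c \<epsilon> \<inter> {a - 1..a + 1}"
    have "x / c \<le> (a + c) / c" "(a - c) / c \<le> x / c"
      using x assms by (auto intro!: divide_right_mono)
    then have "x / c \<le> a / c + 1" "a / c - 1 \<le> x / c"
      using assms by (auto simp: add_divide_distrib diff_divide_distrib)
    then have "\<lfloor>x / c\<rfloor> \<in> K"
      unfolding K_def by (auto; linarith)
    moreover have "of_int \<lfloor>x / c\<rfloor> \<le> x / c" "x / c \<le> of_int \<lfloor>x / c\<rfloor> + \<epsilon>"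
      using x by (auto simp: periodic_gap_def frac_def)
    then have "c * of_int \<lfloor>x / c\<rfloor> \<le> c * (x / c)" "c * (x / c) \<le> c * (of_int \<lfloor>x / c\<rfloor> + \<epsilon>)"
      using assms by (intro mult_left_mono; linarith)+
    then have "x \<in> J \<lfloor>x / c\<rfloor>"
      using assms by (simp add: J_def distrib_left)
    ultimately show "x \<in> (\<Union>k\<in>K. J k)"
      by blast
  qed
  then have "measure lebesgue (periodic_gap c \<epsilon> \<inter> {a - 1..a + 1}) \<le> measure lebesgue (\<Union>k\<in>K. J k)"
    by (intro measure_mono_fmeasurable fmeasurable.finite_UN) (auto simp: K_def J_def)
  also have "\<dots> \<le> (\<Sum>k\<in>K. measure lebesgue (J k))"
    by (intro measure_UNION_le) (auto simp: K_def J_def)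
  also have "\<dots> = 3 * (c * \<epsilon>)"
    using assms by (simp add: K_def J_def)
  also have "\<dots> \<le> 6 * \<epsilon>"
    using assms by simp
  finally show ?thesis .
qed

text \<open>Any two points of I span a segment inside I, so they are at most 1 apart and any point
  of I can serve as \<open>a\<close>. A window of length 2 avoids a case split on the endpoints of
  I.\<close>

lemma unit_length_interval_subset:
  assumes I: "unit_length_interval I"
  obtains a :: real where "I \<subseteq> {a - 1..a + 1}"
proof -
  have em: "emeasure lebesgue I = 1" and iv: "is_interval I"
    using I by (auto simp: unit_length_interval_def)
  \<comment> \<open>\<open>emeasure\<close> is 0 on non-measurable sets, so the value 1 forces
    measurability.\<close>
  have meas: "I \<in> sets lebesgue"
    using em emeasure_notin_sets by fastforce
  then have fm: "I \<in> fmeasurable lebesgue"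
    using em by (intro fmeasurableI) auto
  have dist: "y - x \<le> 1" if "x \<in> I" "y \<in> I" for x y
  proof (cases "x \<le> y")
    case True
    have "{x..y} \<subseteq> I"
      using mem_is_interval_1_I[OF iv that] by auto
    then have "measure lebesgue {x..y} \<le> measure lebesgue I"
      using fm by (intro measure_mono_fmeasurable) auto
    moreover have "measure lebesgue I = 1"
      using em by (simp add: measure_def)
    ultimately show ?thesis
      using True by simp
  next
    case False
    then show ?thesis
      by linarith
  qed
  obtain a where "a \<in> I"
    using em by (cases "I = {}") auto
  then have "I \<subseteq> {a - 1..a + 1}"
    using dist[of a] dist[of _ a] by (force simp: algebra_simps)
  then show thesis ..
qed

theorem corollary3p1:
  fixes lam :: real
  assumes "0 \<le> lam" and "lam < 1"
  shows "\<exists>S :: real set. S \<in> sets lebesgue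
           \<and> (\<forall>I. unit_length_interval I \<longrightarrow> measure lebesgue (S \<inter> I) \<ge> lam)
           \<and> \<not> contains_arith_prog S"
proof -
  have "uncountable {1..2::real}"
    by (simp add: uncountable_closed_interval)
  then obtain c :: real where c: "1 \<le> c" "c \<le> 2" "c \<notin> \<rat>"
    using countable_rat countable_subset by (metis atLeastAtMost_iff subsetI)
  \<comment> \<open>Each of the two gap families removes at most \<open>6 * \<epsilon>\<close> from
    I, and \<open>12 * \<epsilon>\<close> is exactly the permitted loss
    \<open>1 - lam\<close>.\<close>
  define \<epsilon> where "\<epsilon> = (1 - lam) / 12"
  have \<epsilon>: "\<epsilon> > 0"
    using assms by (simp add: \<epsilon>_def)
  define H where "H = periodic_gap 1 \<epsilon> \<union> periodic_gap c \<epsilon>"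
  have H: "H \<in> sets lebesgue"
    unfolding H_def by auto
  have "lam \<le> measure lebesgue (- H \<inter> I)" if I: "unit_length_interval I" for I
  proof -
    obtain a where a: "I \<subseteq> {a - 1..a + 1}"
      using unit_length_interval_subset[OF I] .
    have em: "emeasure lebesgue I = 1"
      using I by (simp add: unit_length_interval_def)
    then have I_sets: "I \<in> sets lebesgue"
      using emeasure_notin_sets by fastforce
    then have I_fm: "I \<in> fmeasurable lebesgue"
      using em by (intro fmeasurableI) auto
    define G where "G d = periodic_gap d \<epsilon> \<inter> {a - 1..a + 1}" for d
    have G: "G d \<in> fmeasurable lebesgue" for d
      unfolding G_def by (subst Int_commute, intro fmeasurable_Int_fmeasurable) auto
    have "measure lebesgue (H \<inter> I) \<le> measure lebesgue (G 1 \<union> G c)"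
      using a H I_sets G by (intro measure_mono_fmeasurable) (auto simp: H_def G_def)
    also have "\<dots> \<le> measure lebesgue (G 1) + measure lebesgue (G c)"
      using G by (intro measure_Un_le) auto
    also have "\<dots> \<le> 6 * \<epsilon> + 6 * \<epsilon>"
      unfolding G_def using c \<epsilon> by (intro add_mono measure_periodic_gap_le) auto
    finally have "measure lebesgue (H \<inter> I) \<le> 1 - lam"
      by (simp add: \<epsilon>_def)
    moreover have "measure lebesgue (I - H \<inter> I) = measure lebesgue I - measure lebesgue (H \<inter> I)"
      using I_fm H I_sets by (intro measurable_measure_Diff) auto
    moreover have "I - H \<inter> I = - H \<inter> I"
      by auto
    moreover have "measure lebesgue I = 1"
      using em by (simp add: measure_def)
    ultimately show ?thesis
      by simp
  qed
  moreover have "\<not> contains_arith_prog (- H)"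
  proof
    assume "contains_arith_prog (- H)"
    then obtain x \<Delta> where \<Delta>: "\<Delta> \<noteq> 0" and avoid: "\<And>n. x + real n * \<Delta> \<notin> H"
      unfolding contains_arith_prog_def by blast
    have "\<Delta> / 1 \<in> \<rat>" "\<Delta> / c \<in> \<rat>"
      using arith_prog_meets_periodic_gap[OF _ \<epsilon>] avoid unfolding H_def by blast+
    \<comment> \<open>This quotient equals \<open>c\<close>, which was chosen irrational.\<close>
    then have "(\<Delta> / 1) / (\<Delta> / c) \<in> \<rat>"
      by (rule Rats_divide)
    with \<Delta> c show False
      by simp
  qed
  moreover have "- H \<in> sets lebesgue"
    using H by (simp add: Compl_in_sets_lebesgue)
  ultimately show ?thesis
    by blast
qed

end
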